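(* For the dynamics on the one dimensional grid with monotone interference sequence $(a_i)_{i\in\mathbb{Z}}$, if $\lambda>\frac{1}{\sum_{i\in\mathbb{Z}}a_i}$, then there exists $N_0$ such that for all $N\ge N_0$, the dynamics truncated to the set $\{-N,\dots,N\}$ is a transient Markov process.
   Context: $\mathbb{N}=\{0,1,2,\dots\}$. Let $\lambda>0$. The interference sequence $(a_i)_{i\in\mathbb{Z}}$ satisfies: $a_i\ge 0$ and $a_i=a_{-i}$ for all $i$, $a_0>0$, and $\{i:a_i>0\}$ is finite. It is monotone if $a_i\ge a_{i+1}$ for all integers $i\ge 0$. The dynamics truncated to $\{-N,\dots,N\}$ is the continuous-time Markov chain $(Y_{-N}(t),\dots,Y_N(t))$ on $\mathbb{N}^{2N+1}$ in which, for each $i\in\{-N,\dots,N\}$, $Y_i$ increases by $1$ at rate $\lambda$ and decreases by $1$ at rate $\frac{Y_i}{\sum_{j=-N}^{N}a_{i-j}Y_j}$ (with $0/0=0$). Equivalently, there are no arrivals to, and no customers in, queues outside $\{-N,\dots,N\}$. *)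

theory Defs
  imports "HOL-Probability.Probability"
begin

section \<open>Continuous-time Markov chains with given jump rates\<close>

text \<open>
  A chain is given by its off-diagonal jump rates \<open>Q x y\<close>; diagonal values are ignored.
  It is realised by the usual jump chain / holding time construction: a discrete-time
  Markov chain \<open>Z\<close> with the jump probabilities, and independent of it a sequence \<open>E\<close>
  of i.i.d. exponential variables of mean 1; the \<open>n\<close>-th holding time is \<open>E n\<close> divided by the
  exit rate of \<open>Z n\<close>.
\<close>

definition exit_rate :: "('s \<Rightarrow> 's \<Rightarrow> real) \<Rightarrow> 's \<Rightarrow> real" where
  "exit_rate Q x = (\<Sum>\<^sub>\<infinity>y\<in>- {x}. Q x y)"

definition jump_pmf :: "('s \<Rightarrow> 's \<Rightarrow> real) \<Rightarrow> 's \<Rightarrow> 's pmf" where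
  "jump_pmf Q x =
     (if exit_rate Q x = 0 then return_pmf x
      else embed_pmf (\<lambda>y. if y = x then 0 else Q x y / exit_rate Q x))"

lemma pmf_jump_pmf:
  assumes nonneg: "\<And>y. y \<noteq> x \<Longrightarrow> 0 \<le> Q x y"
    and summable: "Q x summable_on - {x}"
    and "exit_rate Q x \<noteq> 0"
  shows "pmf (jump_pmf Q x) y = (if y = x then 0 else Q x y / exit_rate Q x)"
proof -
  let ?f = "\<lambda>y. if y = x then 0 else Q x y / exit_rate Q x"
  have pos: "0 \<le> exit_rate Q x"
    unfolding exit_rate_def by (rule infsum_nonneg) (use nonneg in auto)
  have f_nonneg: "0 \<le> ?f y" for y
    using nonneg pos by auto
  have "(Q x has_sum exit_rate Q x) (- {x})"
    unfolding exit_rate_def using summable by (rule has_sum_infsum)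
  then have "((\<lambda>y. Q x y / exit_rate Q x) has_sum exit_rate Q x / exit_rate Q x) (- {x})"
    unfolding divide_inverse by (rule has_sum_cmult_left)
  then have "((\<lambda>y. Q x y / exit_rate Q x) has_sum 1) (- {x})"
    using assms(3) by simp
  then have sum1: "(?f has_sum 1) UNIV"
    by (subst has_sum_cong_neutral[where T = "- {x}" and g = "\<lambda>y. Q x y / exit_rate Q x"]) auto
  have "?f summable_on UNIV"
    using sum1 by (rule has_sum_imp_summable)
  then have f_abs: "Infinite_Set_Sum.abs_summable_on ?f UNIV"
    by (rule summable_on_iff_abs_summable_on_real[THEN iffD1, THEN abs_summable_equivalent[THEN iffD1]])
  have "(\<integral>\<^sup>+ y. ?f y \<partial>count_space UNIV) = ennreal (infsum ?f UNIV)"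
    using nn_integral_conv_infsetsum[OF f_abs f_nonneg] infsetsum_infsum[OF f_abs] by simp
  then have "(\<integral>\<^sup>+ y. ?f y \<partial>count_space UNIV) = 1"
    using infsumI[OF sum1] by simp
  then show ?thesis
    unfolding jump_pmf_def using assms(3) f_nonneg by (simp add: pmf_embed_pmf)
qed

definition jump_kernel :: "('s \<Rightarrow> 's \<Rightarrow> real) \<Rightarrow> 's \<Rightarrow> nat \<Rightarrow> (nat \<Rightarrow> 's) \<Rightarrow> 's measure" where
  "jump_kernel Q x n z =
     measure_pmf (if n = 0 then return_pmf x else jump_pmf Q (z (n - 1)))"

interpretation jump: Ionescu_Tulcea "jump_kernel Q x" "\<lambda>_. count_space UNIV"
  for Q :: "'s \<Rightarrow> 's \<Rightarrow> real" and x :: 's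
proof (rule Ionescu_Tulcea.intro)
  show "jump_kernel Q x n \<in>
      Pi\<^sub>M {0..<n} (\<lambda>_. count_space UNIV) \<rightarrow>\<^sub>M subprob_algebra (count_space UNIV)" for n
  proof (cases n)
    case 0
    then show ?thesis
      by (simp add: jump_kernel_def[abs_def] measure_pmf_in_subprob_algebra)
  next
    case (Suc k)
    have "(\<lambda>z. z k) \<in> Pi\<^sub>M {0..<n} (\<lambda>_. count_space UNIV) \<rightarrow>\<^sub>M (count_space UNIV :: 's measure)"
      using Suc by (intro measurable_component_singleton) auto
    then have "(\<lambda>z. measure_pmf (jump_pmf Q (z k))) \<in>
        Pi\<^sub>M {0..<n} (\<lambda>_. count_space UNIV) \<rightarrow>\<^sub>M subprob_algebra (count_space UNIV)"
      by (rule measurable_compose) (simp add: measure_pmf_in_subprob_algebra)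
    with Suc show ?thesis
      by (simp add: jump_kernel_def[abs_def])
  qed
  show "prob_space (jump_kernel Q x n z)" for n z
    unfolding jump_kernel_def by (rule measure_pmf.prob_space_axioms)
qed

definition jump_chain :: "('s \<Rightarrow> 's \<Rightarrow> real) \<Rightarrow> 's \<Rightarrow> (nat \<Rightarrow> 's) measure" where
  "jump_chain Q x = jump.PF.lim Q x"

lemma emeasure_jump_chain_cylinder:
  "emeasure (jump_chain Q x) {Z. \<forall>k\<le>n. Z k = z k} =
     (if z 0 = x then ennreal (\<Prod>k<n. pmf (jump_pmf Q (z k)) (z (Suc k))) else 0)"
proof -
  let ?M = "\<lambda>_::nat. count_space UNIV" and ?r = "\<lambda>n. restrict z {0..<n}"
  let ?C = "\<lambda>n. jump.C Q x 0 n (\<lambda>_. undefined)"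
  let ?K = "\<lambda>n. emeasure (jump_kernel Q x n z) {z n}"
  have empty: "(\<lambda>_. undefined) \<in> space (Pi\<^sub>M {0..<0} ?M)"
    by (simp add: space_PiM)
  have r_eq: "{?r n} = (\<Pi>\<^sub>E k\<in>{0..<n}. {z k})" for n
    by (auto simp: PiE_iff extensional_def fun_eq_iff)
  have r_sets: "{?r n} \<in> sets (Pi\<^sub>M {0..<n} ?M)" for n
    unfolding r_eq by (rule sets_PiM_I_finite) auto
  have step: "emeasure (jump.eP Q x n \<omega>) {?r (Suc n)} = ?K n * indicator {?r n} \<omega>"
    if \<omega>: "\<omega> \<in> space (Pi\<^sub>M {0..<n} ?M)" for n \<omega>
  proof -
    have ext: "\<omega> \<in> extensional {0..<n}"
      using \<omega> by (simp add: space_PiM PiE_iff)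
    have upd: "fun_upd \<omega> n v = ?r (Suc n) \<longleftrightarrow> \<omega> = ?r n \<and> v = z n" for v
    proof
      assume eq: "fun_upd \<omega> n v = ?r (Suc n)"
      have "\<omega> k = ?r n k" for k
        using fun_cong[OF eq, of k] ext by (cases "k < n") (auto simp: extensional_def)
      moreover have "v = z n"
        using fun_cong[OF eq, of n] by simp
      ultimately show "\<omega> = ?r n \<and> v = z n" by auto
    qed (auto simp: fun_eq_iff)
    have "emeasure (jump.eP Q x n \<omega>) {?r (Suc n)} =
        emeasure (jump_kernel Q x n \<omega>) {v. fun_upd \<omega> n v = ?r (Suc n)}"
      using jump.emeasure_eP[OF \<omega> r_sets[of "Suc n"]] by (simp add: vimage_def)
    also have "\<dots> = ?K n * indicator {?r n} \<omega>"
    proof (cases "\<omega> = ?r n")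
      case True
      then have "jump_kernel Q x n \<omega> = jump_kernel Q x n z"
        by (cases n) (simp_all add: jump_kernel_def)
      moreover have "{v. fun_upd \<omega> n v = ?r (Suc n)} = {z n}"
        using True unfolding upd by blast
      moreover have "indicator {?r n} \<omega> = (1 :: ennreal)"
        using True by (simp only: indicator_simps singletonI)
      ultimately show ?thesis by (simp only: mult_1_right)
    next
      case False
      then have "{v. fun_upd \<omega> n v = ?r (Suc n)} = {}"
        unfolding upd by blast
      moreover have "indicator {?r n} \<omega> = (0 :: ennreal)"
        using False by (simp only: indicator_simps singleton_iff simp_thms)
      ultimately show ?thesis by (simp only: mult_zero_right emeasure_empty)
    qed
    finally show ?thesis .
  qed
  have C: "emeasure (?C n) {?r n} = (\<Prod>k<n. ?K k)" for n
  proof (induction n)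
    case 0
    then show ?case
      using r_sets[of 0] by (simp add: restrict_def)
  next
    case (Suc n)
    have sC: "space (?C n) = space (Pi\<^sub>M {0..<n} ?M)" and "sets (?C n) = sets (Pi\<^sub>M {0..<n} ?M)"
      using jump.space_C[OF empty, of Q x n] jump.sets_C[OF empty, of Q x n] by simp_all
    have "emeasure (?C (Suc n)) {?r (Suc n)} =
        (\<integral>\<^sup>+ \<omega>. emeasure (jump.eP Q x n \<omega>) {?r (Suc n)} \<partial>?C n)"
    proof -
      have "space (?C n) \<noteq> {}"
        using jump.prob_space_C[OF empty] by (rule prob_space.not_empty)
      moreover have "jump.eP Q x n \<in> ?C n \<rightarrow>\<^sub>M subprob_algebra (Pi\<^sub>M {0..<Suc n} ?M)"
        using jump.measurable_eP[of Q x n] by (simp only: measurable_cong_sets[OF \<open>sets (?C n) = _\<close> refl])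
      ultimately show ?thesis
        unfolding jump.C.simps(2) add_0 using r_sets by (rule emeasure_bind)
    qed
    also have "\<dots> = (\<integral>\<^sup>+ \<omega>. ?K n * indicator {?r n} \<omega> \<partial>?C n)"
      by (intro nn_integral_cong step) (simp add: sC)
    also have "\<dots> = ?K n * emeasure (?C n) {?r n}"
      using r_sets[of n] \<open>sets (?C n) = _\<close> by (simp add: nn_integral_cmult_indicator)
    finally show ?case
      unfolding Suc prod.lessThan_Suc by (simp only: mult.commute)
  qed
  have emb: "{Z. \<forall>k\<le>n. Z k = z k} = prod_emb UNIV ?M {0..<Suc n} {?r (Suc n)}"
  proof -
    have "(\<forall>k\<le>n. Z k = z k) \<longleftrightarrow> restrict Z {0..<Suc n} = ?r (Suc n)" for Z
      unfolding fun_eq_iff restrict_def by (auto simp: less_Suc_eq_le)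
    then show ?thesis
      by (simp add: prod_emb_def space_PiM vimage_def)
  qed
  have "emeasure (jump_chain Q x) {Z. \<forall>k\<le>n. Z k = z k} = emeasure (?C (Suc n)) {?r (Suc n)}"
  proof -
    have "prod_emb {0..<Suc n} ?M {0..<Suc n} {?r (Suc n)} = {?r (Suc n)}"
      by (rule prod_emb_id) (use sets.sets_into_space[OF r_sets[of "Suc n"]] in \<open>simp add: space_PiM\<close>)
    then show ?thesis
      unfolding jump_chain_def emb jump.lim[OF finite_atLeastLessThan r_sets]
      by (simp only: jump.emeasure_CI[OF subset_refl r_sets])
  qed
  also have "\<dots> = ?K 0 * (\<Prod>k<n. ?K (Suc k))"
    unfolding C by (rule prod.lessThan_Suc_shift)
  also have "(\<Prod>k<n. ?K (Suc k)) = ennreal (\<Prod>k<n. pmf (jump_pmf Q (z k)) (z (Suc k)))"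
    by (simp add: jump_kernel_def emeasure_pmf_single prod_ennreal)
  also have "?K 0 = (if z 0 = x then 1 else 0)"
    by (simp add: jump_kernel_def)
  finally show ?thesis
    by (simp split: if_splits)
qed

definition clocks :: "(nat \<Rightarrow> real) measure" where
  "clocks = (\<Pi>\<^sub>M n\<in>UNIV. density lborel (exponential_density 1))"

definition ctmc_space :: "('s \<Rightarrow> 's \<Rightarrow> real) \<Rightarrow> 's \<Rightarrow> ((nat \<Rightarrow> 's) \<times> (nat \<Rightarrow> real)) measure" where
  "ctmc_space Q x = jump_chain Q x \<Otimes>\<^sub>M clocks"

text \<open>In \<^typ>\<open>ennreal\<close>, a positive number divided by 0 is \<open>\<infinity>\<close>: absorbing states are never left.\<close>

definition jump_time ::
  "('s \<Rightarrow> 's \<Rightarrow> real) \<Rightarrow> nat \<Rightarrow> (nat \<Rightarrow> 's) \<times> (nat \<Rightarrow> real) \<Rightarrow> ennreal" where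
  "jump_time Q n = (\<lambda>(Z, E). \<Sum>k<n. ennreal (E k) / ennreal (exit_rate Q (Z k)))"

text \<open>The value \<^const>\<open>None\<close> is the cemetery state, entered after an explosion.\<close>

definition ctmc ::
  "('s \<Rightarrow> 's \<Rightarrow> real) \<Rightarrow> real \<Rightarrow> (nat \<Rightarrow> 's) \<times> (nat \<Rightarrow> real) \<Rightarrow> 's option" where
  "ctmc Q t \<omega> =
     (if \<exists>n. jump_time Q n \<omega> \<le> ennreal t \<and> ennreal t < jump_time Q (Suc n) \<omega>
      then Some (fst \<omega> (THE n. jump_time Q n \<omega> \<le> ennreal t \<and> ennreal t < jump_time Q (Suc n) \<omega>))
      else None)"

text \<open>
  A state is transient if, started there, the chain almost surely has a last visit to it; the
  chain on the state space \<open>S\<close> is transient if all its states are.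
\<close>

definition transient_state :: "('s \<Rightarrow> 's \<Rightarrow> real) \<Rightarrow> 's \<Rightarrow> bool" where
  "transient_state Q x \<longleftrightarrow>
     (AE \<omega> in ctmc_space Q x. bounded {t. 0 \<le> t \<and> ctmc Q t \<omega> = Some x})"

definition transient_chain :: "'s set \<Rightarrow> ('s \<Rightarrow> 's \<Rightarrow> real) \<Rightarrow> bool" where
  "transient_chain S Q \<longleftrightarrow> (\<forall>x\<in>S. transient_state Q x)"


section \<open>Interference queueing dynamics on the integer grid\<close>

definition interference_sequence :: "(int \<Rightarrow> real) \<Rightarrow> bool" where
  "interference_sequence a \<longleftrightarrow>
     (\<forall>i. 0 \<le> a i) \<and> (\<forall>i. a i = a (- i)) \<and> 0 < a 0 \<and> finite {i. 0 < a i}"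

definition monotone_interference :: "(int \<Rightarrow> real) \<Rightarrow> bool" where
  "monotone_interference a \<longleftrightarrow> (\<forall>i\<ge>0. a (i + 1) \<le> a i)"

definition window :: "nat \<Rightarrow> int set" where
  "window N = {- int N..int N}"

text \<open>The state space of the truncated dynamics: configurations with no customers outside the window.\<close>

definition truncated_states :: "nat \<Rightarrow> (int \<Rightarrow> nat) set" where
  "truncated_states N = {y. \<forall>i. i \<notin> window N \<longrightarrow> y i = 0}"

definition departure_rate :: "(int \<Rightarrow> real) \<Rightarrow> nat \<Rightarrow> (int \<Rightarrow> nat) \<Rightarrow> int \<Rightarrow> real" where
  "departure_rate a N y i = real (y i) / (\<Sum>j\<in>window N. a (i - j) * real (y j))"

text \<open>For \<open>y i = 0\<close> the departure rate is 0, so truncated subtraction is harmless below.\<close>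

definition truncated_rates ::
  "(int \<Rightarrow> real) \<Rightarrow> real \<Rightarrow> nat \<Rightarrow> (int \<Rightarrow> nat) \<Rightarrow> (int \<Rightarrow> nat) \<Rightarrow> real" where
  "truncated_rates a lam N y z =
     (\<Sum>i\<in>window N. (if z = y(i := y i + 1) then lam else 0)
                   + (if z = y(i := y i - 1) then departure_rate a N y i else 0))"

lemma truncated_rates_nonneg:
  assumes "0 < lam" "interference_sequence a"
  shows "0 \<le> truncated_rates a lam N y z"
  using assms unfolding truncated_rates_def departure_rate_def interference_sequence_def
  by (intro sum_nonneg add_nonneg_nonneg) (auto intro!: divide_nonneg_nonneg sum_nonneg)

lemma finite_truncated_rates: "finite {z. truncated_rates a lam N y z \<noteq> 0}"
proof (rule finite_subset)
  show "{z. truncated_rates a lam N y z \<noteq> 0} \<subseteq>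
      (\<lambda>i. y(i := y i + 1)) ` window N \<union> (\<lambda>i. y(i := y i - 1)) ` window N"
  proof (rule subsetI, rule ccontr)
    fix z
    assume "z \<in> {z. truncated_rates a lam N y z \<noteq> 0}"
      and "z \<notin> (\<lambda>i. y(i := y i + 1)) ` window N \<union> (\<lambda>i. y(i := y i - 1)) ` window N"
    moreover from this(2) have "truncated_rates a lam N y z = 0"
      unfolding truncated_rates_def by (intro sum.neutral) auto
    ultimately show False by simp
  qed
qed (simp add: window_def)

lemma truncated_rates_summable: "truncated_rates a lam N y summable_on A"
  using finite_truncated_rates[of a lam N y]
  by (rule finite_nonzero_values_imp_summable_on[OF finite_subset, rotated]) auto

end

theory Submission
  imports Defs
begin

text \<open>
  If all queues are at least \<open>m c\<^sub>i\<close> with equality at \<open>k\<close>, then queue \<open>k\<close> is served at rate at most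
  \<open>c\<^sub>k / (A c)\<^sub>k\<close>, where \<open>A = (a\<^sub>i\<^sub>-\<^sub>j)\<close>. For the tent \<open>c\<^sub>i = N + 1 - |i|\<close> on a large window
  this is below \<open>\<lambda>\<close>, so \<open>min\<^sub>i y\<^sub>i / c\<^sub>i\<close> tends to grow. The minimum has no pointwise positive drift
  (several queues may attain it), so it is smoothed: \<open>f(y) = \<Sum>\<^sub>i exp (- \<theta> y\<^sub>i / c\<^sub>i)\<close> is superharmonic
  where the minimum is large, and truncating \<open>f\<close> at a small level \<open>\<eta>\<close> makes it superharmonic
  everywhere. Arrivals lead from any state \<open>x\<close> to states where \<open>f < \<eta>\<close>, so some iterate of the
  truncated \<open>f\<close> under the jump operator decreases strictly at \<open>x\<close>. Hence the Green function at \<open>x\<close> is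
  finite and, by Borel--Cantelli, \<open>x\<close> is visited only finitely often.
\<close>

section \<open>Visits of the jump chain\<close>

primrec jump_dist :: "('s \<Rightarrow> 's \<Rightarrow> real) \<Rightarrow> 's \<Rightarrow> nat \<Rightarrow> 's pmf" where
  "jump_dist Q x 0 = return_pmf x"
| "jump_dist Q x (Suc n) = bind_pmf (jump_dist Q x n) (jump_pmf Q)"

text \<open>Projecting one Ionescu-Tulcea step to its last coordinate gives back the kernel, which
  looks only at the previous coordinate; hence the marginals obey the recursion of
  \<open>jump_dist\<close>. The limit measure has the same initial segments as the finite
  stages.\<close>

lemma distr_jump_chain:
  "distr (jump_chain Q x) (count_space UNIV) (\<lambda>Z. Z n) = measure_pmf (jump_dist Q x n)"
proof -
  let ?M = "\<lambda>_::nat. count_space UNIV" and ?U = "count_space UNIV"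
  let ?C = "\<lambda>n. jump.C Q x 0 n (\<lambda>_. undefined)"
  have empty: "(\<lambda>_. undefined) \<in> space (Pi\<^sub>M {0..<0} ?M)"
    by (simp add: space_PiM)
  have sC: "sets (?C n) = sets (Pi\<^sub>M {0..<n} ?M)" for n
    using jump.sets_C[OF empty, of Q x n] by simp
  have spC: "space (?C n) = space (Pi\<^sub>M {0..<n} ?M)" for n
    using sets_eq_imp_space_eq[OF sC] .
  have ne: "space (?C n) \<noteq> {}" for n
    using jump.prob_space_C[OF empty] by (rule prob_space.not_empty)
  have comp: "(\<lambda>\<omega>. \<omega> k) \<in> Pi\<^sub>M {0..<n} ?M \<rightarrow>\<^sub>M ?U" if "k < n" for k n
    using that by (intro measurable_component_singleton) auto
  have last: "distr (jump.eP Q x n \<omega>) ?U (\<lambda>\<omega>. \<omega> n) = jump_kernel Q x n \<omega>"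
    if "\<omega> \<in> space (Pi\<^sub>M {0..<n} ?M)" for n \<omega>
  proof -
    have s: "sets (jump_kernel Q x n \<omega>) = sets ?U"
      by (simp add: jump_kernel_def)
    have m: "fun_upd \<omega> n \<in> jump_kernel Q x n \<omega> \<rightarrow>\<^sub>M Pi\<^sub>M {0..<Suc n} ?M"
      unfolding measurable_cong_sets[OF s refl]
      using that by (intro measurable_fun_upd[where J="{0..<n}"]) auto
    show ?thesis
      unfolding jump.eP_def
      by (subst distr_distr[OF comp m]) (auto simp: comp_def distr_id2 jump_kernel_def)
  qed
  have step: "distr (?C (Suc n)) ?U (\<lambda>\<omega>. \<omega> n) = (?C n \<bind> jump_kernel Q x n)" for n
  proof -
    have eP: "jump.eP Q x n \<in> ?C n \<rightarrow>\<^sub>M subprob_algebra (Pi\<^sub>M {0..<Suc n} ?M)"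
      unfolding measurable_cong_sets[OF sC refl] by (rule jump.measurable_eP)
    have "distr (?C (Suc n)) ?U (\<lambda>\<omega>. \<omega> n) = (?C n \<bind> (\<lambda>\<omega>. distr (jump.eP Q x n \<omega>) ?U (\<lambda>\<omega>. \<omega> n)))"
      unfolding jump.C.simps(2) add_0 by (rule distr_bind[OF eP ne comp]) simp
    also have "\<dots> = (?C n \<bind> jump_kernel Q x n)"
      by (rule bind_cong) (auto simp: spC last)
    finally show ?thesis .
  qed
  have marg: "distr (?C (Suc n)) ?U (\<lambda>\<omega>. \<omega> n) = measure_pmf (jump_dist Q x n)" for n
  proof (induction n)
    case 0
    have "(?C 0 \<bind> jump_kernel Q x 0) = (?C 0 \<bind> (\<lambda>_. measure_pmf (return_pmf x)))"
      by (rule bind_cong) (simp_all add: jump_kernel_def)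
    also have "\<dots> = measure_pmf (return_pmf x)"
      by (rule bind_const'[OF jump.prob_space_C[OF empty] measure_pmf.subprob_space_axioms])
    finally show ?case
      unfolding step by simp
  next
    case (Suc n)
    have c: "(\<lambda>\<omega>. \<omega> n) \<in> ?C (Suc n) \<rightarrow>\<^sub>M ?U"
      unfolding measurable_cong_sets[OF sC refl] by (rule comp) simp
    have "(?C (Suc n) \<bind> jump_kernel Q x (Suc n)) =
        (distr (?C (Suc n)) ?U (\<lambda>\<omega>. \<omega> n) \<bind> (\<lambda>s. measure_pmf (jump_pmf Q s)))"
      by (subst bind_distr[OF c _ ne, where K = ?U])
        (simp_all add: jump_kernel_def[abs_def] measure_pmf_in_subprob_algebra del: jump.C.simps)
    then show ?case
      unfolding step[of "Suc n"] Suc jump_dist.simps measure_pmf_bind .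
  qed
  have res: "(\<lambda>Z. restrict Z {0..<Suc n}) \<in> ?C (Suc n) \<rightarrow>\<^sub>M Pi\<^sub>M {0..<Suc n} ?M"
    unfolding measurable_cong_sets[OF sC refl] by (rule measurable_restrict_subset) simp
  have up: "jump.up_to {0..<Suc n} = Suc n"
    unfolding jump.up_to_def by (rule Least_equality) (auto simp: not_less_eq_eq[symmetric])
  have "distr (jump_chain Q x) ?U (\<lambda>Z. Z n) =
      distr (distr (jump_chain Q x) (Pi\<^sub>M {0..<Suc n} ?M) (\<lambda>Z. restrict Z {0..<Suc n})) ?U (\<lambda>\<omega>. \<omega> n)"
    unfolding jump_chain_def
    by (subst distr_distr[OF comp])
      (auto simp: comp_def measurable_cong_sets[OF jump.PF.sets_lim refl] intro!: measurable_restrict_subset)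
  also have "\<dots> = distr (distr (?C (Suc n)) (Pi\<^sub>M {0..<Suc n} ?M) (\<lambda>Z. restrict Z {0..<Suc n})) ?U (\<lambda>\<omega>. \<omega> n)"
    unfolding jump_chain_def by (subst jump.distr_lim) (simp_all add: jump.CI_def up)
  also have "\<dots> = distr (?C (Suc n)) ?U (\<lambda>\<omega>. \<omega> n)"
    by (subst distr_distr[OF comp res]) (simp_all add: comp_def del: jump.C.simps)
  finally show ?thesis
    unfolding marg .
qed

lemma measurable_jump_chain_component: "(\<lambda>Z. Z n) \<in> jump_chain Q x \<rightarrow>\<^sub>M count_space UNIV"
  unfolding jump_chain_def
  by (simp add: measurable_cong_sets[OF jump.PF.sets_lim refl] measurable_component_singleton)

lemma prob_space_jump_chain: "prob_space (jump_chain Q x)"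
  by (rule prob_space_distrD[OF measurable_jump_chain_component, of _ _ 0])
    (simp add: distr_jump_chain measure_pmf.prob_space_axioms)

text \<open>First Borel-Cantelli lemma for the events \<open>Z n = y\<close>, whose probabilities
  are the summands by \<open>distr_jump_chain\<close>.\<close>

lemma AE_finitely_many_visits:
  assumes "summable (\<lambda>n. pmf (jump_dist Q x n) y)"
  shows "AE Z in jump_chain Q x. finite {n. Z n = y}"
proof -
  interpret prob_space "jump_chain Q x" by (rule prob_space_jump_chain)
  let ?A = "\<lambda>n. (\<lambda>Z. Z n) -` {y} \<inter> space (jump_chain Q x)"
  have A: "?A n \<in> sets (jump_chain Q x)" for n
    by (rule measurable_sets[OF measurable_jump_chain_component]) simp
  have "measure (jump_chain Q x) (?A n) = pmf (jump_dist Q x n) y" for n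
    unfolding pmf.rep_eq distr_jump_chain[symmetric]
    by (subst measure_distr[OF measurable_jump_chain_component]) auto
  then have "AE Z in jump_chain Q x. eventually (\<lambda>n. Z \<in> space (jump_chain Q x) - ?A n) sequentially"
    using assms A by (intro borel_cantelli_AE1) (auto simp: emeasure_eq_measure)
  then show ?thesis
  proof eventually_elim
    case (elim Z)
    then obtain N where "\<forall>n\<ge>N. Z n \<noteq> y"
      by (auto simp: eventually_sequentially)
    then have "{n. Z n = y} \<subseteq> {..<N}" by (auto simp: not_le[symmetric])
    then show ?case by (rule finite_subset) simp
  qed
qed

text \<open>Each visit to \<open>z\<close> costs the expectation of \<open>g\<close> the fixed
  amount \<open>d\<close>, while this expectation never rises and stays in \<open>[0, B]\<close>.
  Telescoping bounds the expected number of visits by \<open>B / d\<close>.\<close>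

lemma summable_superharmonic:
  fixes B :: real
  assumes bound: "\<And>y. 0 \<le> g y" "\<And>y. g y \<le> B"
    and super: "\<And>y. measure_pmf.expectation (jump_pmf Q y) g \<le> g y"
    and strict: "measure_pmf.expectation (jump_pmf Q z) g < g z"
  shows "summable (\<lambda>n. pmf (jump_dist Q x n) z)"
proof -
  let ?p = "jump_dist Q x"
  define e where "e n = measure_pmf.expectation (?p n) g" for n
  define d where "d = g z - measure_pmf.expectation (jump_pmf Q z) g"
  have int: "integrable (measure_pmf q) f" if "\<And>y. 0 \<le> f y" "\<And>y. f y \<le> B" for q :: "'a pmf" and f
    using that by (intro measure_pmf.integrable_const_bound[where B = B]) auto
  have e: "0 \<le> e n" "e n \<le> B" for n
    unfolding e_def by (auto intro!: integral_nonneg_AE measure_pmf.integral_le_const int bound)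
  have Pg: "0 \<le> measure_pmf.expectation (jump_pmf Q y) g" "measure_pmf.expectation (jump_pmf Q y) g \<le> B" for y
    by (auto intro!: integral_nonneg_AE measure_pmf.integral_le_const int bound)
  have "e (Suc n) \<le> e n - d * pmf (?p n) z" for n
  proof -
    have "e (Suc n) = (\<integral>y. measure_pmf.expectation (jump_pmf Q y) g \<partial>?p n)"
      unfolding e_def jump_dist.simps measure_pmf_bind
      using bound by (intro integral_bind[where K = "count_space UNIV" and B = B and B' = 1])
        (auto simp: measure_pmf_in_subprob_algebra measure_pmf.finite_measure)
    \<comment> \<open>Superharmonicity away from \<open>z\<close>; at \<open>z\<close> equality
      holds by the choice of \<open>d\<close>.\<close>
    also have "\<dots> \<le> (\<integral>y. g y - d * indicator {z} y \<partial>?p n)"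
      using super by (intro integral_mono int Pg) (auto simp: d_def indicator_def Pg bound)
    also have "\<dots> = e n - d * pmf (?p n) z"
      by (subst Bochner_Integration.integral_diff)
        (auto simp: int bound e_def measure_pmf_single measure_pmf.emeasure_eq_measure
          intro!: integrable_real_indicator)
    finally show ?thesis .
  qed
  then have d: "d * pmf (?p n) z \<le> e n - e (Suc n)" for n
    by (simp add: algebra_simps)
  have "d * (\<Sum>n<m. pmf (?p n) z) \<le> B" for m
  proof -
    have "d * (\<Sum>n<m. pmf (?p n) z) \<le> (\<Sum>n<m. e n - e (Suc n))"
      unfolding sum_distrib_left by (intro sum_mono d)
    also have "\<dots> = e 0 - e m" by (rule sum_lessThan_telescope')
    finally show ?thesis using e(2)[of 0] e(1)[of m] by linarith
  qed
  moreover have "0 < d" using strict by (simp add: d_def)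
  ultimately have "(\<Sum>n<m. pmf (?p n) z) \<le> B / d" for m
    by (simp add: field_simps)
  then show ?thesis
    by (intro summableI_nonneg_bounded[where x = "B / d"]) auto
qed

section \<open>From the jump chain to continuous time\<close>

lemma jump_time_mono: "m \<le> n \<Longrightarrow> jump_time Q m \<omega> \<le> jump_time Q n \<omega>"
  unfolding jump_time_def by (auto simp: split_beta intro!: sum_mono2)

lemma ctmc_eq_SomeD:
  assumes "ctmc Q t \<omega> = Some x"
  obtains n where "fst \<omega> n = x" "ennreal t < jump_time Q (Suc n) \<omega>"
proof -
  let ?P = "\<lambda>n. jump_time Q n \<omega> \<le> ennreal t \<and> ennreal t < jump_time Q (Suc n) \<omega>"
  obtain n where n: "?P n" using assms by (auto simp: ctmc_def split: if_splits)
  \<comment> \<open>Jump times are nondecreasing, so the intervals between consecutive ones are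
    disjoint and the \<open>THE\<close> in \<open>ctmc\<close> is well defined.\<close>
  have "m = n" if "?P m" for m
    using n that jump_time_mono[of "Suc m" n Q \<omega>] jump_time_mono[of "Suc n" m Q \<omega>]
    by (cases m n rule: linorder_cases) (auto simp: Suc_le_eq)
  then have "(THE n. ?P n) = n" using n by blast
  then show ?thesis using assms n that by (auto simp: ctmc_def split: if_splits)
qed

text \<open>Positive exit rates make every jump time finite, so the end of the last stay in
  \<open>x\<close> bounds all times spent there. An explosion does no harm, since
  \<open>ctmc\<close> is \<open>None\<close> afterwards.\<close>

lemma transient_stateI:
  assumes rate: "\<And>y. 0 < exit_rate Q y"
    and fin: "AE Z in jump_chain Q x. finite {n. Z n = x}"
  shows "transient_state Q x"
proof -
  interpret J: prob_space "jump_chain Q x" by (rule prob_space_jump_chain)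
  interpret C: prob_space clocks
    unfolding clocks_def by (intro prob_space_PiM prob_space_exponential_density) simp
  interpret pair_sigma_finite "jump_chain Q x" clocks ..
  have bdd: "bounded {t. 0 \<le> t \<and> ctmc Q t \<omega> = Some x}" if f: "finite {n. fst \<omega> n = x}" for \<omega>
  proof -
    obtain K where K: "\<And>n. fst \<omega> n = x \<Longrightarrow> n \<le> K"
      using f by (auto simp: finite_nat_set_iff_bounded_le)
    \<comment> \<open>\<open>ennreal\<close> reads a negative clock value as 0, so finiteness holds
      for every path and not only almost surely.\<close>
    have "ennreal r / ennreal (exit_rate Q y) < \<infinity>" for r y
      using rate[of y] by (cases "0 \<le> r") (simp_all add: divide_ennreal ennreal_neg)
    then have "jump_time Q (Suc K) \<omega> < \<infinity>"
      unfolding jump_time_def by (simp add: split_beta)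
    then obtain T where T: "0 \<le> T" "jump_time Q (Suc K) \<omega> = ennreal T"
      by (cases "jump_time Q (Suc K) \<omega>") auto
    have "t \<le> T" if t: "0 \<le> t" "ctmc Q t \<omega> = Some x" for t
    proof -
      obtain n where n: "fst \<omega> n = x" "ennreal t < jump_time Q (Suc n) \<omega>"
        using t by (elim ctmc_eq_SomeD)
      then have "ennreal t < ennreal T"
        using jump_time_mono[of "Suc n" "Suc K" Q \<omega>] K T by fastforce
      then show ?thesis using T(1) t(1) by (simp add: ennreal_less_iff)
    qed
    then show ?thesis
      by (intro boundedI[where B = T]) auto
  qed
  \<comment> \<open>The exceptional pairs lie in the product of a null set of the jump chain with
    all clock sequences.\<close>
  have "AE \<omega> in ctmc_space Q x. finite {n. fst \<omega> n = x}"
  proof -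
    obtain N where N: "N \<in> null_sets (jump_chain Q x)"
        "{Z \<in> space (jump_chain Q x). \<not> finite {n. Z n = x}} \<subseteq> N"
      using fin by (auto elim!: AE_E3)
    have "N \<times> space clocks \<in> null_sets (ctmc_space Q x)"
      unfolding ctmc_space_def using N(1)
      by (intro null_setsI) (auto simp: C.emeasure_pair_measure_Times null_sets_def)
    then show ?thesis
      by (rule AE_I') (use N(2) in \<open>auto simp: ctmc_space_def space_pair_measure\<close>)
  qed
  then show ?thesis
    unfolding transient_state_def by eventually_elim (rule bdd)
qed

section \<open>The jump operator and iterates of superharmonic functions\<close>

definition jump_op :: "('s \<Rightarrow> 's \<Rightarrow> real) \<Rightarrow> ('s \<Rightarrow> real) \<Rightarrow> 's \<Rightarrow> real" where
  "jump_op Q u y = measure_pmf.expectation (jump_pmf Q y) u"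

text \<open>\<open>jump_op\<close> is monotone on functions with values in \<open>[0, B]\<close>,
  where integrability is automatic, so applying it to both sides preserves
  \<open>jump_op Q h \<le> h\<close>.\<close>

lemma superharmonic_iterate:
  fixes B :: real
  assumes bound: "\<And>y. 0 \<le> h y" "\<And>y. h y \<le> B"
    and super: "\<And>y. jump_op Q h y \<le> h y"
  shows "0 \<le> (jump_op Q ^^ j) h y" "(jump_op Q ^^ j) h y \<le> B"
    "(jump_op Q ^^ Suc j) h y \<le> (jump_op Q ^^ j) h y"
proof -
  let ?h = "\<lambda>j. (jump_op Q ^^ j) h"
  have int: "integrable (measure_pmf q) f" if "\<And>y. 0 \<le> f y" "\<And>y. f y \<le> B" for q :: "'a pmf" and f
    using that by (intro measure_pmf.integrable_const_bound[where B = B]) auto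
  have h: "(\<forall>y. 0 \<le> ?h j y) \<and> (\<forall>y. ?h j y \<le> B) \<and> (\<forall>y. jump_op Q (?h j) y \<le> ?h j y)" for j
  proof (induction j)
    case 0
    then show ?case using bound super by simp
  next
    case (Suc j)
    have b: "0 \<le> ?h (Suc j) y" "?h (Suc j) y \<le> B" for y
      using Suc by (auto simp: jump_op_def[of Q "?h j"] intro!: integral_nonneg_AE measure_pmf.integral_le_const int)
    then have "jump_op Q (?h (Suc j)) y \<le> jump_op Q (?h j) y" for y
      using Suc unfolding jump_op_def[of Q _ y] by (intro integral_mono int) auto
    then show ?case using b by simp
  qed
  from h[of j] show "0 \<le> ?h j y" "?h j y \<le> B" "?h (Suc j) y \<le> ?h j y"
    by simp_all
qed

text \<open>A strict drop after \<open>k\<close> steps must occur at some single step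
  \<open>j\<close>, and the iterate \<open>?h j\<close> is then superharmonic with strict inequality
  at \<open>x\<close>. Thus \<open>h\<close> itself may be flat around \<open>x\<close>.\<close>

lemma summable_superharmonic_iterate:
  fixes B :: real
  assumes bound: "\<And>y. 0 \<le> h y" "\<And>y. h y \<le> B"
    and super: "\<And>y. jump_op Q h y \<le> h y"
    and strict: "(jump_op Q ^^ k) h x < h x"
  shows "summable (\<lambda>n. pmf (jump_dist Q x n) x)"
proof -
  let ?h = "\<lambda>j. (jump_op Q ^^ j) h"
  note h = superharmonic_iterate[of h B Q, OF bound super]
  obtain j where "?h (Suc j) x < ?h j x"
  proof (rule ccontr)
    assume "\<not> thesis"
    then have step: "?h j x \<le> ?h (Suc j) x" for j
      using that by (meson not_le)
    have "?h 0 x \<le> ?h k x"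
      by (rule lift_Suc_mono_le[where f = "\<lambda>j. ?h j x"]) (use step in auto)
    then show False using strict by simp
  qed
  then show ?thesis
    using h[of j] unfolding funpow.simps comp_apply jump_op_def[of Q "?h j"]
    by (intro summable_superharmonic[where g = "?h j" and B = B])
qed

section \<open>Drift of the exponential potential\<close>

definition truncated_drift :: "(int \<Rightarrow> real) \<Rightarrow> real \<Rightarrow> nat \<Rightarrow> ((int \<Rightarrow> nat) \<Rightarrow> real) \<Rightarrow> (int \<Rightarrow> nat) \<Rightarrow> real" where
  "truncated_drift a lam N u y =
     (\<Sum>i\<in>window N. lam * (u (y(i := y i + 1)) - u y) + departure_rate a N y i * (u (y(i := y i - 1)) - u y))"

lemma finite_window [simp]: "finite (window N)"
  by (simp add: window_def)

lemma zero_in_window [simp]: "0 \<in> window N"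
  by (simp add: window_def)

lemma window_nonempty [simp]: "window N \<noteq> {}"
  using zero_in_window by blast

lemma departure_rate_nonneg:
  "interference_sequence a \<Longrightarrow> 0 \<le> departure_rate a N y i"
  unfolding departure_rate_def interference_sequence_def
  by (auto intro!: divide_nonneg_nonneg sum_nonneg)

text \<open>All rates out of \<open>y\<close> live on a finite set of neighbours, so one jump
  changes \<open>u\<close> on average by generator over exit rate. Superharmonicity thus becomes a
  question about the sign of \<open>truncated_drift\<close>.\<close>

lemma
  assumes lam: "0 < lam" and a: "interference_sequence a"
  shows exit_rate_truncated_pos: "0 < exit_rate (truncated_rates a lam N) y"
    and jump_op_truncated:
      "jump_op (truncated_rates a lam N) u y =
        u y + truncated_drift a lam N u y / exit_rate (truncated_rates a lam N) y"
proof -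
  let ?Q = "truncated_rates a lam N" and ?W = "window N"
  let ?up = "\<lambda>i. y(i := y i + 1)" and ?dn = "\<lambda>i. y(i := y i - 1)"
  define F where "F = insert y (?up ` ?W \<union> ?dn ` ?W)"
  have F: "finite F" by (simp add: F_def)
  have zero: "?Q y z = 0" if "z \<notin> F" for z
    using that unfolding truncated_rates_def F_def by (intro sum.neutral) auto
  \<comment> \<open>Used twice: the indicator of \<open>z \<noteq> y\<close> as \<open>w\<close>
    gives the exit rate, and \<open>w z = u z - u y\<close> gives the drift.\<close>
  have sumF: "(\<Sum>z\<in>F. ?Q y z * w z) =
      (\<Sum>i\<in>?W. lam * w (?up i) + departure_rate a N y i * w (?dn i))" for w :: "(int \<Rightarrow> nat) \<Rightarrow> real"
  proof -
    have "(\<Sum>z\<in>F. ?Q y z * w z) =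
      (\<Sum>i\<in>?W. \<Sum>z\<in>F. (if z = ?up i then lam * w z else 0) + (if z = ?dn i then departure_rate a N y i * w z else 0))"
      unfolding truncated_rates_def sum_distrib_right
      by (subst sum.swap) (auto intro!: sum.cong simp: algebra_simps)
    also have "\<dots> = (\<Sum>i\<in>?W. lam * w (?up i) + departure_rate a N y i * w (?dn i))"
      unfolding sum.distrib sum.delta[OF F] by (auto intro!: arg_cong2[of _ _ _ _ "(+)"] sum.cong simp: F_def)
    finally show ?thesis .
  qed
  have exit: "exit_rate ?Q y = (\<Sum>z\<in>F. ?Q y z * (if z = y then 0 else 1))"
  proof -
    have "exit_rate ?Q y = (\<Sum>\<^sub>\<infinity>z\<in>F. ?Q y z * (if z = y then 0 else 1))"
      unfolding exit_rate_def by (rule infsum_cong_neutral) (auto simp: zero)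
    then show ?thesis using F by simp
  qed
  \<comment> \<open>An arrival at queue 0 always changes the state, and its rate bounds the exit
    rate from below.\<close>
  have "0 < lam * (if ?up 0 = y then 0 else 1)"
    using lam by (auto simp: fun_eq_iff)
  also have "\<dots> \<le> lam * (if ?up 0 = y then 0 else 1) + departure_rate a N y 0 * (if ?dn 0 = y then 0 else 1)"
    using departure_rate_nonneg[OF a] by simp
  also have "\<dots> \<le> exit_rate ?Q y"
    unfolding exit sumF
    by (rule member_le_sum[where f = "\<lambda>i. lam * (if ?up i = y then 0 else 1) + departure_rate a N y i * (if ?dn i = y then 0 else 1)"])
      (use lam departure_rate_nonneg[OF a] in auto)
  finally show pos: "0 < exit_rate ?Q y" .
  have pmf: "pmf (jump_pmf ?Q y) z = (if z = y then 0 else ?Q y z / exit_rate ?Q y)" for z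
    using pos truncated_rates_nonneg[OF lam a] truncated_rates_summable by (intro pmf_jump_pmf) auto
  have supp: "set_pmf (jump_pmf ?Q y) \<subseteq> F"
    using zero by (auto simp: set_pmf_iff pmf split: if_splits) (metis)
  have "jump_op ?Q u y - u y = (\<Sum>z\<in>F. u z * pmf (jump_pmf ?Q y) z) - u y * (\<Sum>z\<in>F. pmf (jump_pmf ?Q y) z)"
    using supp F unfolding jump_op_def by (subst integral_measure_pmf_real[of F]) (auto simp: sum_pmf_eq_1)
  also have "\<dots> = (\<Sum>z\<in>F. (u z - u y) * pmf (jump_pmf ?Q y) z)"
    by (simp add: sum_distrib_left sum_subtractf algebra_simps)
  \<comment> \<open>At \<open>z = y\<close> the factor \<open>u z - u y\<close> vanishes, so the
    excluded diagonal makes no difference.\<close>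
  also have "\<dots> = (\<Sum>z\<in>F. ?Q y z * (u z - u y)) / exit_rate ?Q y"
    unfolding sum_divide_distrib by (intro sum.cong) (auto simp: pmf)
  also have "\<dots> = truncated_drift a lam N u y / exit_rate ?Q y"
    unfolding sumF truncated_drift_def ..
  finally show "jump_op ?Q u y = u y + truncated_drift a lam N u y / exit_rate ?Q y" by simp
qed

section \<open>Sums of exponentials as a smooth minimum\<close>

definition exp_potential :: "nat \<Rightarrow> (int \<Rightarrow> real) \<Rightarrow> (int \<Rightarrow> nat) \<Rightarrow> real" where
  "exp_potential N t y = (\<Sum>i\<in>window N. exp (- t i * real (y i)))"

lemma exp_potential_upd:
  assumes "i \<in> window N"
  shows "exp_potential N t (y(i := v)) - exp_potential N t y = exp (- t i * real v) - exp (- t i * real (y i))"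
  using assms by (simp add: exp_potential_def sum.remove[of _ i])

text \<open>An arrival multiplies the \<open>i\<close>-th exponential by \<open>exp (- t i)\<close>,
  a departure by \<open>exp (t i)\<close>; both increments share the factor
  \<open>exp (t i) - 1\<close>. For \<open>t i > 0\<close> the sign of a summand is that of its last
  factor.\<close>

lemma truncated_drift_exp_potential:
  "truncated_drift a lam N (exp_potential N t) y =
     (\<Sum>i\<in>window N. exp (- t i * real (y i)) * (exp (t i) - 1) * (departure_rate a N y i - lam * exp (- t i)))"
  unfolding truncated_drift_def
proof (rule sum.cong[OF refl])
  fix i assume i: "i \<in> window N"
  let ?E = "exp (- t i * real (y i))" and ?d = "departure_rate a N y i"
  have up: "exp (- t i * real (y i + 1)) - ?E = - ?E * (exp (t i) - 1) * exp (- t i)"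
    by (simp add: algebra_simps exp_add exp_diff exp_minus field_simps)
  \<comment> \<open>The factor \<open>?d\<close> is kept because the identity without it fails for
    \<open>y i = 0\<close>, where \<open>?d = 0\<close>.\<close>
  have dn: "?d * (exp (- t i * real (y i - 1)) - ?E) = ?d * (?E * (exp (t i) - 1))"
  proof (cases "y i = 0")
    case True
    then show ?thesis by (simp add: departure_rate_def)
  next
    case False
    then have "- t i * real (y i - 1) = - t i * real (y i) + t i"
      by (simp add: of_nat_diff algebra_simps)
    then have "exp (- t i * real (y i - 1)) = ?E * exp (t i)"
      by (simp only: exp_add)
    then show ?thesis by (simp only: right_diff_distrib mult_1_right)
  qed
  show "lam * (exp_potential N t (y(i := y i + 1)) - exp_potential N t y) +
      ?d * (exp_potential N t (y(i := y i - 1)) - exp_potential N t y) =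
      ?E * (exp (t i) - 1) * (?d - lam * exp (- t i))"
    unfolding exp_potential_upd[OF i] up dn by (simp add: algebra_simps)
qed

text \<open>The gap is split as \<open>\<mu> < \<kappa>1 < \<kappa>2 < lam\<close>: queues near the
  minimum are served at rate at most \<open>\<kappa>1\<close>, while their arrivals still count at
  least \<open>\<kappa>2\<close>. The surplus at the minimal queue outweighs all distant queues once
  the minimum is large.\<close>

lemma exp_potential_drift_nonpos:
  assumes a: "interference_sequence a"
    and c: "\<And>i. i \<in> window N \<Longrightarrow> 1 \<le> c i"
    and ev: "\<And>i. i \<in> window N \<Longrightarrow> c i \<le> \<mu> * (\<Sum>j\<in>window N. a (i - j) * c j)"
    and \<mu>: "0 < \<mu>" "\<mu> < lam"
  obtains \<theta> M where "0 < \<theta>" "0 < M"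
    "\<forall>y. (\<forall>i\<in>window N. M * c i \<le> real (y i)) \<longrightarrow>
       truncated_drift a lam N (exp_potential N (\<lambda>i. \<theta> / c i)) y \<le> 0"
proof -
  let ?W = "window N"
  obtain \<kappa>2 where \<kappa>2: "\<mu> < \<kappa>2" "\<kappa>2 < lam" using dense \<mu>(2) by blast
  obtain \<kappa>1 where \<kappa>1: "\<mu> < \<kappa>1" "\<kappa>1 < \<kappa>2" using dense \<kappa>2(1) by blast
  \<comment> \<open>Chosen so that \<open>lam * exp (- \<theta>) = \<kappa>2\<close>; as
    \<open>c i \<ge> 1\<close>, the unit jump size costs no more than this.\<close>
  define \<theta> where "\<theta> = ln (lam / \<kappa>2)"
  have \<theta>: "0 < \<theta>" using \<kappa>2 \<mu> by (simp add: \<theta>_def)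
  have lam\<theta>: "lam * exp (- \<theta>) = \<kappa>2"
    using \<kappa>2 \<mu> by (simp add: \<theta>_def exp_minus field_simps)
  \<comment> \<open>Exceeding the minimal ratio by the factor \<open>1 + \<delta>\<close> raises the
    bound on the service rate from \<open>\<mu>\<close> to \<open>\<kappa>1\<close>.\<close>
  define \<delta> where "\<delta> = \<kappa>1 / \<mu> - 1"
  have \<delta>: "0 < \<delta>" "(1 + \<delta>) * \<mu> = \<kappa>1" using \<kappa>1 \<mu> by (simp_all add: \<delta>_def)
  have a0: "0 < a 0" and a_nonneg: "\<And>i. 0 \<le> a i" using a by (auto simp: interference_sequence_def)
  define B where "B = (\<Sum>i\<in>?W. c i)"
  have B: "c i \<le> B" if "i \<in> ?W" for i
    unfolding B_def using that c by (intro member_le_sum) (auto intro: order_trans[of 0 1])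
  \<comment> \<open>Up to the factor \<open>exp (- (\<theta> * m))\<close>, a lower bound for the
    gain at the minimal queue \<open>k\<close>, from \<open>exp s - 1 \<ge> s\<close> and
    \<open>c k \<le> B\<close>.\<close>
  define b where "b = \<theta> / B * (\<kappa>2 - \<kappa>1)"
  have "1 \<le> B" using c[of 0] B[of 0] by simp
  then have b: "0 < b" using \<theta> \<kappa>1 by (simp add: b_def)
  \<comment> \<open>Bounds the loss from all distant queues, apart from their exponential
    weight.\<close>
  define C where "C = real (card ?W) * ((exp \<theta> - 1) / a 0)"
  have "0 < card ?W" by (simp add: card_gt_0_iff)
  then have C: "0 < C" using \<theta> a0 by (simp add: C_def)
  \<comment> \<open>Solves \<open>C * exp (- (\<theta> * \<delta> * M)) \<le> b\<close>; the maximum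
    with 1 keeps \<open>M\<close> positive.\<close>
  define M where "M = max 1 (ln (C / b) / (\<theta> * \<delta>))"
  have "0 < M" by (simp add: M_def)
  have Mb: "C * exp (- (\<theta> * \<delta> * m)) \<le> b" if "M \<le> m" for m
  proof -
    have "ln (C / b) / (\<theta> * \<delta>) \<le> m" using that by (simp add: M_def)
    then have "ln (C / b) \<le> \<theta> * \<delta> * m" using \<theta> \<delta> by (simp add: field_simps)
    then have "C / b \<le> exp (\<theta> * \<delta> * m)" using C b by (metis divide_pos_pos exp_le_cancel_iff exp_ln)
    then show ?thesis using b by (simp add: exp_minus field_simps)
  qed
  show ?thesis
  proof (rule that[OF \<theta> \<open>0 < M\<close>], intro allI impI)
    fix y :: "int \<Rightarrow> nat"
    assume "\<forall>i\<in>?W. M * c i \<le> real (y i)"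
    then have y: "\<And>i. i \<in> ?W \<Longrightarrow> M * c i \<le> real (y i)" by blast
    define r where "r i = real (y i) / c i" for i
    obtain k where k: "k \<in> ?W" and min: "\<And>i. i \<in> ?W \<Longrightarrow> r k \<le> r i"
    proof -
      have "Min (r ` ?W) \<in> r ` ?W" by (intro Min_in) auto
      then obtain k where "k \<in> ?W" "r k = Min (r ` ?W)" by (metis imageE)
      then show ?thesis by (intro that[of k]) auto
    qed
    define m where "m = r k"
    have cpos: "0 < c i" if "i \<in> ?W" for i using c[OF that] by simp
    have "M \<le> m" using y[OF k] cpos[OF k] by (simp add: m_def r_def field_simps)
    then have m: "0 < m" using \<open>0 < M\<close> by simp
    let ?A = "\<lambda>i. \<Sum>j\<in>?W. a (i - j) * real (y j)" and ?d = "departure_rate a N y"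
    define T where "T i = exp (- (\<theta> * r i)) * (exp (\<theta> / c i) - 1) * (?d i - lam * exp (- (\<theta> / c i)))" for i
    have ym: "m * c i \<le> real (y i)" if "i \<in> ?W" for i
      using min[OF that] cpos[OF that] by (simp add: m_def r_def field_simps)
    have A: "m * (\<Sum>j\<in>?W. a (i - j) * c j) \<le> ?A i" for i
      unfolding sum_distrib_left
      by (rule sum_mono) (use ym a_nonneg in \<open>auto simp: mult.left_commute[of m] intro!: mult_left_mono\<close>)
    \<comment> \<open>The interference at \<open>i\<close> is at least that of the profile
      \<open>m * c\<close>, so a queue of length exactly \<open>m * c i\<close> would be served at
      rate at most \<open>\<mu>\<close>.\<close>
    have Apos: "0 < ?A i" "c i * m \<le> \<mu> * ?A i" if i: "i \<in> ?W" for i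
    proof -
      have "c i * m \<le> \<mu> * (\<Sum>j\<in>?W. a (i - j) * c j) * m"
        using ev[OF i] m by (intro mult_right_mono) auto
      also have "\<dots> \<le> \<mu> * ?A i" using A[of i] \<mu> by (simp add: algebra_simps)
      finally show *: "c i * m \<le> \<mu> * ?A i" .
      have "0 < c i * m" using m cpos[OF i] by simp
      then have "0 < \<mu> * ?A i" using * by linarith
      then show "0 < ?A i" using \<mu> by (simp add: zero_less_mult_iff)
    qed
    \<comment> \<open>The queue's own term in the denominator caps its service rate.\<close>
    have dmax: "?d i \<le> 1 / a 0" if i: "i \<in> ?W" for i
    proof -
      have "a (i - i) * real (y i) \<le> ?A i"
        using i a_nonneg by (intro member_le_sum[where f = "\<lambda>j. a (i - j) * real (y j)"]) auto
      then show ?thesis using Apos[OF i] a0 by (simp add: departure_rate_def field_simps)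
    qed
    have t: "0 < \<theta> / c i" "\<theta> / c i \<le> \<theta>" if "i \<in> ?W" for i
      using \<theta> c[OF that] by (simp_all add: field_simps)
    text \<open>
      Queues with \<open>r i\<close> within a factor \<open>1 + \<delta>\<close> of the minimum contribute nonpositively; the others carry
      a weight exponentially smaller than the one of the minimal queue \<open>k\<close>.
    \<close>
    have near: "T i \<le> - (exp (- (\<theta> * r i)) * (exp (\<theta> / c i) - 1) * (\<kappa>2 - \<kappa>1))"
      if i: "i \<in> ?W" and r: "r i \<le> (1 + \<delta>) * m" for i
    proof -
      have "real (y i) \<le> (1 + \<delta>) * (c i * m)"
        using r cpos[OF i] by (simp add: r_def field_simps)
      also have "\<dots> \<le> (1 + \<delta>) * (\<mu> * ?A i)"
        using Apos[OF i] \<delta> by (intro mult_left_mono) auto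
      also have "\<dots> = \<kappa>1 * ?A i" using \<delta>(2) by (simp add: mult.assoc[symmetric])
      finally have d: "?d i \<le> \<kappa>1" using Apos(1)[OF i] by (simp add: departure_rate_def field_simps)
      have "\<kappa>2 \<le> lam * exp (- (\<theta> / c i))"
        using t[OF i] \<mu> unfolding lam\<theta>[symmetric] by (intro mult_left_mono) auto
      then have "?d i - lam * exp (- (\<theta> / c i)) \<le> - (\<kappa>2 - \<kappa>1)" using d by linarith
      then have "T i \<le> exp (- (\<theta> * r i)) * (exp (\<theta> / c i) - 1) * (- (\<kappa>2 - \<kappa>1))"
        unfolding T_def using t(1)[OF i] by (intro mult_left_mono mult_nonneg_nonneg) auto
      then show ?thesis unfolding mult_minus_right .
    qed
    let ?R = "exp (- (\<theta> * ((1 + \<delta>) * m))) * ((exp \<theta> - 1) / a 0)"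
    have R: "0 \<le> ?R" using \<theta> a0 by simp
    have far: "T i \<le> ?R" if i: "i \<in> ?W" for i
    proof (cases "r i \<le> (1 + \<delta>) * m")
      case True
      have "0 \<le> exp (- (\<theta> * r i)) * (exp (\<theta> / c i) - 1) * (\<kappa>2 - \<kappa>1)"
        using t(1)[OF i] \<kappa>1 by (intro mult_nonneg_nonneg) auto
      then show ?thesis using near[OF i True] R by linarith
    next
      case False
      \<comment> \<open>Far from the minimum the helpful arrival term is simply dropped.\<close>
      have "T i \<le> exp (- (\<theta> * r i)) * (exp (\<theta> / c i) - 1) * (1 / a 0)"
        unfolding T_def using t(1)[OF i] dmax[OF i] \<mu>
        by (intro mult_left_mono mult_nonneg_nonneg) (auto intro: order_trans[rotated])
      also have "\<dots> \<le> exp (- (\<theta> * ((1 + \<delta>) * m))) * (exp \<theta> - 1) * (1 / a 0)"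
        using t[OF i] False \<theta> a0 by (intro mult_right_mono mult_mono) auto
      finally show ?thesis by simp
    qed
    have "T k \<le> - (exp (- (\<theta> * m)) * (exp (\<theta> / c k) - 1) * (\<kappa>2 - \<kappa>1))"
      using near[OF k] m \<delta> by (simp add: m_def algebra_simps)
    also have "\<dots> \<le> - (exp (- (\<theta> * m)) * b)"
    proof -
      have "\<theta> / B \<le> \<theta> / c k" using B[OF k] cpos[OF k] \<theta> by (intro divide_left_mono) auto
      also have "\<dots> \<le> exp (\<theta> / c k) - 1" using exp_ge_add_one_self[of "\<theta> / c k"] by linarith
      finally have "b \<le> (exp (\<theta> / c k) - 1) * (\<kappa>2 - \<kappa>1)"
        unfolding b_def using \<kappa>1 by (intro mult_right_mono) auto
      then show ?thesis by (simp add: mult.assoc)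
    qed
    finally have Tk: "T k \<le> - (exp (- (\<theta> * m)) * b)" .
    have "truncated_drift a lam N (exp_potential N (\<lambda>i. \<theta> / c i)) y = (\<Sum>i\<in>?W. T i)"
      unfolding truncated_drift_exp_potential by (rule sum.cong) (simp_all add: T_def r_def)
    also have "\<dots> = T k + (\<Sum>i\<in>?W - {k}. T i)"
      using k by (simp add: sum.remove)
    also have "\<dots> \<le> - (exp (- (\<theta> * m)) * b) + (\<Sum>i\<in>?W. ?R)"
    proof (intro add_mono Tk)
      have "(\<Sum>i\<in>?W - {k}. T i) \<le> (\<Sum>i\<in>?W - {k}. ?R)" using far by (intro sum_mono) auto
      also have "\<dots> \<le> (\<Sum>i\<in>?W. ?R)" using R by (intro sum_mono2) auto
      finally show "(\<Sum>i\<in>?W - {k}. T i) \<le> (\<Sum>i\<in>?W. ?R)" .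
    qed
    also have "(\<Sum>i\<in>?W. ?R) = exp (- (\<theta> * m)) * (C * exp (- (\<theta> * \<delta> * m)))"
      by (simp add: C_def algebra_simps exp_add exp_diff exp_minus field_simps)
    also have "- (exp (- (\<theta> * m)) * b) + exp (- (\<theta> * m)) * (C * exp (- (\<theta> * \<delta> * m))) \<le> 0"
      using Mb[OF \<open>M \<le> m\<close>] by (simp add: mult_left_mono)
    finally show "truncated_drift a lam N (exp_potential N (\<lambda>i. \<theta> / c i)) y \<le> 0" .
  qed
qed

section \<open>Transience from a subeigenvector of the interference matrix\<close>

text \<open>With queues in proportion to \<open>c\<close>, each is served at rate at most
  \<open>\<mu>\<close>, below the arrival rate; this is the content of \<open>ev\<close>.\<close>

lemma transient_chain_of_profile:
  assumes lam: "0 < lam" and a: "interference_sequence a"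
    and c: "\<And>i. i \<in> window N \<Longrightarrow> 1 \<le> c i"
    and ev: "\<And>i. i \<in> window N \<Longrightarrow> c i \<le> \<mu> * (\<Sum>j\<in>window N. a (i - j) * c j)"
    and \<mu>: "0 < \<mu>" "\<mu> < lam"
  shows "transient_chain (truncated_states N) (truncated_rates a lam N)"
  unfolding transient_chain_def
proof
  fix x :: "int \<Rightarrow> nat"
  let ?Q = "truncated_rates a lam N" and ?W = "window N"
  obtain \<theta> M where \<theta>: "0 < \<theta>" "0 < M" and
    drift: "\<forall>y. (\<forall>i\<in>?W. M * c i \<le> real (y i)) \<longrightarrow>
       truncated_drift a lam N (exp_potential N (\<lambda>i. \<theta> / c i)) y \<le> 0"
    using exp_potential_drift_nonpos[OF a c ev \<mu>] .
  define f where "f = exp_potential N (\<lambda>i. \<theta> / c i)"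
  \<comment> \<open>The first bound makes \<open>f y < \<eta>\<close> force
    \<open>y i \<ge> M * c i\<close> on the window; the second puts \<open>x\<close> where
    \<open>h\<close> takes its maximal value \<open>\<eta>\<close>.\<close>
  define \<eta> where "\<eta> = min (exp (- (\<theta> * M))) (f x)"
  define h where "h y = min (f y) \<eta>" for y
  have f_pos: "0 < f y" for y
    unfolding f_def exp_potential_def by (rule sum_pos) auto
  then have \<eta>: "0 < \<eta>" by (simp add: \<eta>_def)
  have h: "0 \<le> h y" "h y \<le> \<eta>" for y
    using f_pos[of y] \<eta> by (simp_all add: h_def)
  have rate: "0 < exit_rate ?Q y" for y
    by (rule exit_rate_truncated_pos[OF lam a])
  note op = jump_op_truncated[OF lam a, of N]
  note d = departure_rate_nonneg[OF a, of N]
  \<comment> \<open>Where \<open>f y < \<eta>\<close>, \<open>h\<close> agrees with \<open>f\<close>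
    at \<open>y\<close> and lies below it elsewhere; otherwise \<open>h\<close> is maximal at
    \<open>y\<close> and no increment is positive.\<close>
  have "truncated_drift a lam N h y \<le> 0" for y
  proof (cases "f y < \<eta>")
    case True
    have "M * c i \<le> real (y i)" if i: "i \<in> ?W" for i
    proof -
      have "exp (- (\<theta> / c i) * real (y i)) \<le> f y"
        unfolding f_def exp_potential_def
        using i by (intro member_le_sum[where f = "\<lambda>i. exp (- (\<theta> / c i) * real (y i))"]) auto
      also have "\<dots> < exp (- (\<theta> * M))" using True by (simp add: \<eta>_def)
      finally have "\<theta> * M < \<theta> / c i * real (y i)" by simp
      then show ?thesis using \<theta> c[OF i] by (simp add: field_simps)
    qed
    then have "truncated_drift a lam N f y \<le> 0" unfolding f_def using drift by blast
    moreover have "h z - h y \<le> f z - f y" for z using True by (simp add: h_def)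
    then have "truncated_drift a lam N h y \<le> truncated_drift a lam N f y"
      unfolding truncated_drift_def using lam d by (intro sum_mono add_mono mult_left_mono) auto
    ultimately show ?thesis by linarith
  next
    case False
    then have "h z - h y \<le> 0" for z by (simp add: h_def)
    then show ?thesis
      unfolding truncated_drift_def using lam d
      by (intro sum_nonpos add_nonpos_nonpos mult_nonneg_nonpos) auto
  qed
  then have super: "jump_op ?Q h y \<le> h y" for y
    using rate[of y] unfolding op by (simp add: divide_nonpos_pos)
  let ?h = "\<lambda>k. (jump_op ?Q ^^ k) h"
  note iter = superharmonic_iterate[of h \<eta> ?Q, OF h super]
  \<comment> \<open>Since \<open>h \<le> \<eta>\<close>, this says that the jump chain from
    \<open>y\<close> enters the set \<open>f < \<eta>\<close> with positive probability, without
    mention of paths.\<close>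
  define reach where "reach y \<longleftrightarrow> (\<exists>k. ?h k y < \<eta>)" for y
  \<comment> \<open>If \<open>?h k\<close> is still maximal at \<open>y\<close>, all increments are
    nonpositive and the arrival at \<open>i\<close>, of rate \<open>lam > 0\<close>, gives a
    negative one; so the next iterate drops.\<close>
  have arrival: "reach y" if r: "reach (y(i := y i + 1))" and i: "i \<in> ?W" for y i
  proof -
    obtain k where k: "?h k (y(i := y i + 1)) < \<eta>" using r by (auto simp: reach_def)
    show ?thesis
    proof (cases "?h k y < \<eta>")
      case True
      then show ?thesis by (auto simp: reach_def)
    next
      case False
      then have eq: "?h k y = \<eta>" using iter(2)[of k y] by simp
      have le: "?h k z - \<eta> \<le> 0" for z using iter(2)[of k z] by simp
      have "truncated_drift a lam N (?h k) y < 0"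
        unfolding truncated_drift_def eq
      proof -
        let ?t = "\<lambda>i. lam * (?h k (y(i := y i + 1)) - \<eta>) + departure_rate a N y i * (?h k (y(i := y i - 1)) - \<eta>)"
        have t: "departure_rate a N y i * (?h k z - \<eta>) \<le> 0" for i z
          using d le by (rule mult_nonneg_nonpos)
        have "lam * (?h k (y(i := y i + 1)) - \<eta>) < 0" using k lam by (simp add: mult_pos_neg)
        then have "?t i < 0" using t[of i "y(i := y i - 1)"] by linarith
        moreover have "?t j \<le> 0" for j
          using lam le by (intro add_nonpos_nonpos[OF mult_nonneg_nonpos t]) auto
        then have "(\<Sum>j\<in>?W - {i}. ?t j) \<le> 0" by (intro sum_nonpos)
        ultimately show "(\<Sum>j\<in>?W. ?t j) < 0" using i by (simp add: sum.remove[of _ i])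
      qed
      then have "?h (Suc k) y < \<eta>"
        using rate[of y] eq by (simp add: op divide_neg_pos)
      then show ?thesis unfolding reach_def by blast
    qed
  qed
  have arrivals1: "reach y" if "reach (y(i := y i + n))" "i \<in> ?W" for y i n
    using that(1)
  proof (induction n arbitrary: y)
    case (Suc n)
    have "(y(i := y i + 1))(i := (y(i := y i + 1)) i + n) = y(i := y i + Suc n)" by simp
    then have "reach ((y(i := y i + 1))(i := (y(i := y i + 1)) i + n))"
      using Suc.prems by metis
    then have "reach (y(i := y i + 1))" by (rule Suc.IH)
    then show ?case using that(2) by (rule arrival)
  qed simp
  have arrivals: "reach y" if "finite F" "F \<subseteq> ?W" "reach (\<lambda>j. if j \<in> F then y j + n else y j)" for F y n
    using that
  proof (induction F arbitrary: y)
    case (insert i F)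
    let ?y = "y(i := y i + n)"
    have "(\<lambda>j. if j \<in> insert i F then y j + n else y j) = (\<lambda>j. if j \<in> F then ?y j + n else ?y j)"
      using insert.hyps by auto
    then have r: "reach (\<lambda>j. if j \<in> F then ?y j + n else ?y j)"
      using insert.prems by metis
    have "i \<in> ?W" "F \<subseteq> ?W" using insert.prems by auto
    from insert.IH[OF this(2) r] this(1) show ?case by (rule arrivals1)
  qed simp
  \<comment> \<open>Adding \<open>n\<close> customers to every queue makes each exponential decay
    geometrically in \<open>n\<close>.\<close>
  have "(\<lambda>n. f (\<lambda>j. if j \<in> ?W then x j + n else x j)) \<longlonglongrightarrow> 0"
    unfolding f_def exp_potential_def
  proof (rule tendsto_null_sum)
    fix i assume i: "i \<in> ?W"
    define t where "t = \<theta> / c i"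
    have t: "0 < t" using \<theta> c[OF i] by (simp add: t_def)
    have "(\<lambda>n. exp (- t * real (x i)) * exp (- t) ^ n) \<longlonglongrightarrow> exp (- t * real (x i)) * 0"
      using t by (intro tendsto_mult_left LIMSEQ_realpow_zero) auto
    moreover have "exp (- t * real (if i \<in> ?W then x i + n else x i)) = exp (- t * real (x i)) * exp (- t) ^ n" for n
      using i by (simp add: exp_of_nat_mult[symmetric] exp_add[symmetric] algebra_simps)
    ultimately show "(\<lambda>n. exp (- (\<theta> / c i) * real (if i \<in> ?W then x i + n else x i))) \<longlonglongrightarrow> 0"
      unfolding t_def[symmetric] by simp
  qed
  then have "eventually (\<lambda>n. f (\<lambda>j. if j \<in> ?W then x j + n else x j) < \<eta>) sequentially"
    using \<eta> by (rule order_tendstoD)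
  then obtain n where n: "f (\<lambda>j. if j \<in> ?W then x j + n else x j) < \<eta>"
    by (auto simp: eventually_sequentially)
  then have "?h 0 (\<lambda>j. if j \<in> ?W then x j + n else x j) < \<eta>"
    by (simp add: h_def)
  then have "reach (\<lambda>j. if j \<in> ?W then x j + n else x j)"
    unfolding reach_def by blast
  then have "reach x" by (rule arrivals[OF finite_window subset_refl])
  then obtain k where "?h k x < \<eta>" unfolding reach_def by blast
  moreover have "h x = \<eta>" by (simp add: h_def \<eta>_def)
  ultimately have "summable (\<lambda>n. pmf (jump_dist ?Q x n) x)"
    by (intro summable_superharmonic_iterate[of h \<eta> ?Q k, OF h super]) simp
  then show "transient_state ?Q x"
    by (intro transient_stateI rate AE_finitely_many_visits)
qed

section \<open>The tent as a subeigenvector on large windows\<close>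

text \<open>Convolving the symmetric \<open>a\<close> with an affine function multiplies it by the
  total mass \<open>S\<close>, and \<open>\<mu> * S > 1\<close>. The kink at the apex is felt only
  within the range \<open>L\<close> of \<open>a\<close>, and cutting off at 0 can only help.\<close>

lemma tent_profile:
  fixes a :: "int \<Rightarrow> real" and \<mu> :: real
  assumes a: "interference_sequence a" and \<mu>: "1 / (\<Sum>\<^sub>\<infinity>i\<in>UNIV. a i) < \<mu>"
  obtains N\<^sub>0 where "\<And>N i. N\<^sub>0 \<le> N \<Longrightarrow> i \<in> window N \<Longrightarrow>
    of_int (int N + 1 - \<bar>i\<bar>) \<le> \<mu> * (\<Sum>j\<in>window N. a (i - j) * of_int (int N + 1 - \<bar>j\<bar>))"
proof -
  have nonneg: "\<And>i. 0 \<le> a i" and sym: "\<And>i. a (- i) = a i" and a0: "0 < a 0" and fin: "finite {i. 0 < a i}"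
    using a by (auto simp: interference_sequence_def)
  obtain L :: int where L: "\<And>k. 0 < a k \<Longrightarrow> \<bar>k\<bar> \<le> L"
  proof -
    have "finite (abs ` {i. 0 < a i})" using fin by simp
    then show ?thesis using that[of "Max (abs ` {i. 0 < a i})"] by simp
  qed
  have a_zero: "a k = 0" if "L < \<bar>k\<bar>" for k
    using L[of k] that nonneg[of k] by force
  have "0 \<le> L" using L[OF a0] by simp
  let ?I = "{- L..L}"
  define S where "S = (\<Sum>k\<in>?I. a k)"
  define K where "K = (\<Sum>k\<in>?I. a k * of_int \<bar>k\<bar>)"
  have "(\<Sum>\<^sub>\<infinity>i\<in>UNIV. a i) = (\<Sum>\<^sub>\<infinity>i\<in>?I. a i)"
    by (rule infsum_cong_neutral) (auto intro!: a_zero)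
  then have S: "(\<Sum>\<^sub>\<infinity>i\<in>UNIV. a i) = S" by (simp add: S_def)
  have "a 0 \<le> S" unfolding S_def using \<open>0 \<le> L\<close> nonneg by (intro member_le_sum) auto
  then have "0 < S" using a0 by simp
  have "0 < \<mu>" using \<mu> \<open>0 < S\<close> unfolding S by (meson less_trans zero_less_divide_1_iff)
  have \<mu>S: "1 < \<mu> * S" using \<mu> \<open>0 < S\<close> unfolding S by (simp add: field_simps)
  have odd: "(\<Sum>k\<in>?I. a k * of_int k) = 0"
  proof -
    have "(\<Sum>k\<in>?I. a k * of_int k) = (\<Sum>k\<in>?I. a (- k) * of_int (- k))"
      by (rule sum.reindex_bij_witness[of _ uminus uminus]) auto
    then show ?thesis by (simp add: sym sum_negf)
  qed
  \<comment> \<open>Makes \<open>(\<mu> * S - 1) * c i \<ge> \<mu> * K\<close> for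
    \<open>\<bar>i\<bar> \<le> L\<close>, so the surplus covers the loss at the apex.\<close>
  obtain N\<^sub>0 :: nat where N\<^sub>0: "\<mu> * K / (\<mu> * S - 1) + of_int L \<le> real N\<^sub>0"
    using real_arch_simple by blast
  show ?thesis
  proof (rule that)
    fix N and i :: int
    assume N: "N\<^sub>0 \<le> N" and i: "i \<in> window N"
    define c :: "int \<Rightarrow> real" where "c j = of_int (int N + 1 - \<bar>j\<bar>)" for j
    have ci: "1 \<le> c i"
      using i unfolding c_def window_def of_int_1_le_iff by auto
    \<comment> \<open>The positive part extends the tent by 0 outside the window, so the window sum
      becomes a full convolution.\<close>
    have conv: "(\<Sum>k\<in>?I. a k * max 0 (c (i - k))) = (\<Sum>j\<in>window N. a (i - j) * c j)"
    proof -
      have "(\<Sum>k\<in>?I. a k * max 0 (c (i - k))) = (\<Sum>j\<in>{i - L..i + L}. a (i - j) * max 0 (c j))"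
        by (rule sum.reindex_bij_witness[of _ "\<lambda>j. i - j" "\<lambda>k. i - k"]) auto
      also have "\<dots> = (\<Sum>j\<in>window N. a (i - j) * max 0 (c j))"
        by (rule sum.mono_neutral_cong) (auto simp: c_def window_def max_def intro!: a_zero)
      also have "\<dots> = (\<Sum>j\<in>window N. a (i - j) * c j)"
        by (intro sum.cong) (auto simp: c_def window_def max_def)
      finally show ?thesis .
    qed
    text \<open>
      The tent is bounded below by an affine function through its value at \<open>i\<close>, with no loss by
      symmetry, unless \<open>i\<close> is near the apex; there \<open>c i\<close> is large compared with the loss \<open>K\<close>.
    \<close>
    have "c i \<le> \<mu> * (\<Sum>k\<in>?I. a k * max 0 (c (i - k)))"
    proof (cases "\<bar>i\<bar> \<le> L")
      case True
      \<comment> \<open>Near the apex only the triangle inequality for \<open>i - k\<close> is used,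
        at the price \<open>K\<close>.\<close>
      have "S * c i - K = (\<Sum>k\<in>?I. a k * (c i - of_int \<bar>k\<bar>))"
        by (simp add: S_def K_def sum_distrib_right sum_subtractf right_diff_distrib)
      also have "\<dots> \<le> (\<Sum>k\<in>?I. a k * max 0 (c (i - k)))"
        using nonneg by (intro sum_mono mult_left_mono) (auto simp: c_def)
      finally have "\<mu> * (S * c i - K) \<le> \<mu> * (\<Sum>k\<in>?I. a k * max 0 (c (i - k)))"
        using \<open>0 < \<mu>\<close> by (intro mult_left_mono) auto
      moreover have "\<mu> * K / (\<mu> * S - 1) \<le> c i"
        using True N N\<^sub>0 by (simp add: c_def)
      then have "\<mu> * K \<le> c i * (\<mu> * S - 1)" using \<mu>S by (simp add: pos_divide_le_eq)
      ultimately show ?thesis by (simp add: algebra_simps)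
    next
      case False
      \<comment> \<open>For \<open>\<bar>k\<bar> \<le> L < \<bar>i\<bar>\<close> there is no sign
        change between \<open>i\<close> and \<open>i - k\<close>, so the bracket is exactly
        \<open>c (i - k)\<close>.\<close>
      have "S * c i = (\<Sum>k\<in>?I. a k * (c i + of_int (sgn i * k)))"
      proof -
        have "(\<Sum>k\<in>?I. a k * of_int (sgn i * k)) = of_int (sgn i) * (\<Sum>k\<in>?I. a k * of_int k)"
          by (simp add: sum_distrib_left mult_ac)
        then show ?thesis
          by (simp add: odd S_def sum_distrib_right distrib_left sum.distrib)
      qed
      also have "\<dots> \<le> (\<Sum>k\<in>?I. a k * max 0 (c (i - k)))"
        using nonneg False by (intro sum_mono mult_left_mono) (auto simp: c_def sgn_if max_def)
      finally have "\<mu> * (S * c i) \<le> \<mu> * (\<Sum>k\<in>?I. a k * max 0 (c (i - k)))"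
        using \<open>0 < \<mu>\<close> by (intro mult_left_mono) auto
      moreover have "c i * 1 \<le> c i * (\<mu> * S)" using \<mu>S ci by (intro mult_left_mono) auto
      ultimately show ?thesis by (simp add: algebra_simps)
    qed
    then show "of_int (int N + 1 - \<bar>i\<bar>) \<le> \<mu> * (\<Sum>j\<in>window N. a (i - j) * of_int (int N + 1 - \<bar>j\<bar>))"
      unfolding conv by (simp add: c_def)
  qed
qed

theorem theorem11p2:
  fixes a :: "int \<Rightarrow> real" and lam :: real
  assumes "0 < lam"
    and "interference_sequence a"
    and "monotone_interference a"
    and "lam > 1 / (\<Sum>\<^sub>\<infinity>i\<in>UNIV. a i)"
  shows "\<exists>N\<^sub>0. \<forall>N\<ge>N\<^sub>0. transient_chain (truncated_states N) (truncated_rates a lam N)"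
proof -
  \<comment> \<open>The gap below \<open>\<mu>\<close> pays for the apex of the tent, the gap
    between \<open>\<mu>\<close> and \<open>lam\<close> for the smoothing.\<close>
  have "max 0 (1 / (\<Sum>\<^sub>\<infinity>i\<in>UNIV. a i)) < lam" using assms(1,4) by simp
  then obtain \<mu> where "max 0 (1 / (\<Sum>\<^sub>\<infinity>i\<in>UNIV. a i)) < \<mu>" and lam: "\<mu> < lam"
    using dense by blast
  then have \<mu>: "0 < \<mu>" "1 / (\<Sum>\<^sub>\<infinity>i\<in>UNIV. a i) < \<mu>" by simp_all
  obtain N\<^sub>0 where N\<^sub>0: "\<And>N i. N\<^sub>0 \<le> N \<Longrightarrow> i \<in> window N \<Longrightarrow>
    of_int (int N + 1 - \<bar>i\<bar>) \<le> \<mu> * (\<Sum>j\<in>window N. a (i - j) * of_int (int N + 1 - \<bar>j\<bar>))"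
    using tent_profile[OF assms(2) \<mu>(2)] by blast
  have "transient_chain (truncated_states N) (truncated_rates a lam N)" if "N\<^sub>0 \<le> N" for N
  proof (rule transient_chain_of_profile[OF assms(1,2) _ N\<^sub>0[OF that] \<mu>(1) lam])
    \<comment> \<open>The tent vanishes only at distance \<open>N + 1\<close>, so it is at least 1
      on the whole window.\<close>
    show "1 \<le> real_of_int (int N + 1 - \<bar>i\<bar>)" if "i \<in> window N" for i
      using that unfolding window_def of_int_1_le_iff by auto
  qed
  then show ?thesis by blast
qed

end
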